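(* Let $F^{12},F^{13},F^{23}$ be real fundamental matrices. There exist cameras $P_1,P_2,P_3$ with collinear centers such that $F^{ij}=\psi(P_i,P_j)$ (up to nonzero scale) for $1\le i<j\le3$ if and only if $$e_1^2=e_1^3,\qquad e_2^1=e_2^3,\qquad e_3^1=e_3^2$$ (as points of $\mathbb{P}^2$) and, up to nonzero scaling, $$(F^{12})^T[e_1^2]_\times F^{13}=F^{23}.$$
   Context: Everything is over $\mathbb{R}$. A camera is a rank-3 real $3\times 4$ matrix (up to nonzero scale); its center is its kernel, a point of $\mathbb{P}^3$. A fundamental matrix is a rank-2 real $3\times 3$ matrix (up to nonzero scale). For $3\times 4$ matrices $P_1,P_2$, $\psi(P_1,P_2)$ is the $3\times3$ matrix $F$ (up to scale) with $\det\begin{bmatrix}P_1&x&0\\P_2&0&y\end{bmatrix}=x^TFy$ for all $x,y\in\mathbb{R}^3$. Convention: $F^{ji}=(F^{ij})^T$. The epipole $e_j^i\in\mathbb{R}^3$ is a nonzero vector spanning $\ker F^{ij}$. For $t\in\mathbb{R}^3$, $[t]_\times=\begin{bmatrix}0&-t_3&t_2\\t_3&0&-t_1\\-t_2&t_1&0\end{bmatrix}$, so $[t]_\times u=t\times u$. *)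

theory Defs
  imports "HOL-Analysis.Analysis"
begin

text \<open>
  Projective objects (points of projective space, cameras, fundamental matrices) are handled
  through nonzero real representatives; \<open>proj_eq\<close> is equality up to a nonzero scalar.
\<close>

definition proj_eq :: "'a::real_vector \<Rightarrow> 'a \<Rightarrow> bool"  (infix "\<doteq>" 50) where
  "u \<doteq> v \<longleftrightarrow> (\<exists>c. c \<noteq> 0 \<and> u = c *\<^sub>R v)"

text \<open>\<^typ>\<open>real^4^3\<close> is the type of matrices with 3 rows and 4 columns.\<close>

definition is_camera :: "real^4^3 \<Rightarrow> bool" where
  "is_camera P \<longleftrightarrow> rank P = 3"

definition is_fundamental :: "real^3^3 \<Rightarrow> bool" where
  "is_fundamental F \<longleftrightarrow> rank F = 2"

definition mat_ker :: "real^'n^'m \<Rightarrow> (real^'n) set" where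
  "mat_ker A = {v. A *v v = 0}"

text \<open>
  The center of a camera is a point of projective 3-space, i.e. a one-dimensional linear
  subspace of \<^typ>\<open>real^4\<close>.  Lines of projective 3-space are the two-dimensional subspaces.
\<close>

definition center :: "real^4^3 \<Rightarrow> (real^4) set" where
  "center P = mat_ker P"

definition collinear_centers :: "real^4^3 \<Rightarrow> real^4^3 \<Rightarrow> real^4^3 \<Rightarrow> bool" where
  "collinear_centers P1 P2 P3 \<longleftrightarrow>
     (\<exists>L. subspace L \<and> dim L = 2 \<and> center P1 \<subseteq> L \<and> center P2 \<subseteq> L \<and> center P3 \<subseteq> L)"

definition joint_mat :: "real^4^3 \<Rightarrow> real^4^3 \<Rightarrow> real^3 \<Rightarrow> real^3 \<Rightarrow> real^6^6" where
  "joint_mat P1 P2 x y = vector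
     [vector [P1$1$1, P1$1$2, P1$1$3, P1$1$4, x$1, 0],
      vector [P1$2$1, P1$2$2, P1$2$3, P1$2$4, x$2, 0],
      vector [P1$3$1, P1$3$2, P1$3$3, P1$3$4, x$3, 0],
      vector [P2$1$1, P2$1$2, P2$1$3, P2$1$4, 0, y$1],
      vector [P2$2$1, P2$2$2, P2$2$3, P2$2$4, 0, y$2],
      vector [P2$3$1, P2$3$2, P2$3$3, P2$3$4, 0, y$3]]"

text \<open>The matrix exists by \<open>det_joint_mat\<close> and is unique by \<open>psi_eqI\<close> below.\<close>

definition psi :: "real^4^3 \<Rightarrow> real^4^3 \<Rightarrow> real^3^3" where
  "psi P1 P2 = (THE F. \<forall>x y. det (joint_mat P1 P2 x y) = x \<bullet> (F *v y))"

definition is_epipole :: "real^3^3 \<Rightarrow> real^3 \<Rightarrow> bool" where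
  "is_epipole F e \<longleftrightarrow> e \<noteq> 0 \<and> span {e} = mat_ker F"

definition cross_mat :: "real^3 \<Rightarrow> real^3^3" where
  "cross_mat t = vector
     [vector [0, - (t$3), t$2],
      vector [t$3, 0, - (t$1)],
      vector [- (t$2), t$1, 0]]"

lemma cross_mat_mult: "cross_mat t *v u = cross3 t u"
  by (simp add: cross_mat_def cross3_def vec_eq_iff forall_3 matrix_vector_mult_def sum_3)

lemma exhaust_6:
  fixes x :: 6
  shows "x = 1 \<or> x = 2 \<or> x = 3 \<or> x = 4 \<or> x = 5 \<or> x = 6"
proof (induct x)
  case (of_int z)
  then have "0 \<le> z" and "z < 6" by simp_all
  then have "z = 0 \<or> z = 1 \<or> z = 2 \<or> z = 3 \<or> z = 4 \<or> z = 5" by arith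
  then show ?case by auto
qed

lemma forall_6: "(\<forall>i::6. Q i) \<longleftrightarrow> Q 1 \<and> Q 2 \<and> Q 3 \<and> Q 4 \<and> Q 5 \<and> Q 6"
  by (metis exhaust_6)

lemma vector_6 [simp]:
  "(vector [a,b,c,d,e,f] :: ('a::zero)^6)$1 = a"
  "(vector [a,b,c,d,e,f] :: ('a::zero)^6)$2 = b"
  "(vector [a,b,c,d,e,f] :: ('a::zero)^6)$3 = c"
  "(vector [a,b,c,d,e,f] :: ('a::zero)^6)$4 = d"
  "(vector [a,b,c,d,e,f] :: ('a::zero)^6)$5 = e"
  "(vector [a,b,c,d,e,f] :: ('a::zero)^6)$6 = f"
  unfolding vector_def by simp_all

lemma linear_det_joint_mat_left: "linear (\<lambda>x. det (joint_mat P1 P2 x y))"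
proof -
  define c where "c = (\<lambda>i. transpose (joint_mat P1 P2 0 y) $ i)"
  define g where "g = (\<lambda>x::real^3. vector [x$1, x$2, x$3, 0, 0, 0] :: real^6)"
  have eq: "det (joint_mat P1 P2 x y) = det (\<chi> i. if i = 5 then g x else c i)" for x
  proof -
    have "transpose (joint_mat P1 P2 x y) = (\<chi> i. if i = 5 then g x else c i)"
      by (simp add: vec_eq_iff forall_6 c_def g_def transpose_def joint_mat_def)
    then show ?thesis by (metis det_transpose)
  qed
  have "g (x + x') = g x + g x'" "g (r *\<^sub>R x) = r *s g x" for x x' r
    by (simp_all add: g_def vec_eq_iff forall_6)
  then show ?thesis
    by (intro linearI)
      (simp_all only: eq real_scaleR_def
        det_row_add[of 5 "\<lambda>_. g a" "\<lambda>_. g b" c for a b, symmetric]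
        det_row_mul[of 5 r "\<lambda>_. g a" c for r a, symmetric])
qed

lemma linear_det_joint_mat_right: "linear (\<lambda>y. det (joint_mat P1 P2 x y))"
proof -
  define c where "c = (\<lambda>i. transpose (joint_mat P1 P2 x 0) $ i)"
  define g where "g = (\<lambda>y::real^3. vector [0, 0, 0, y$1, y$2, y$3] :: real^6)"
  have eq: "det (joint_mat P1 P2 x y) = det (\<chi> i. if i = 6 then g y else c i)" for y
  proof -
    have "transpose (joint_mat P1 P2 x y) = (\<chi> i. if i = 6 then g y else c i)"
      by (simp add: vec_eq_iff forall_6 c_def g_def transpose_def joint_mat_def)
    then show ?thesis by (metis det_transpose)
  qed
  have "g (x + x') = g x + g x'" "g (r *\<^sub>R x) = r *s g x" for x x' r
    by (simp_all add: g_def vec_eq_iff forall_6)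
  then show ?thesis
    by (intro linearI)
      (simp_all only: eq real_scaleR_def
        det_row_add[of 6 "\<lambda>_. g a" "\<lambda>_. g b" c for a b, symmetric]
        det_row_mul[of 6 r "\<lambda>_. g a" c for r a, symmetric])
qed

lemma bilinear_form_unique:
  fixes F G :: "real^'n^'m"
  assumes "\<And>x y. x \<bullet> (F *v y) = x \<bullet> (G *v y)"
  shows "F = G"
proof -
  have "F *v y = G *v y" for y
    using assms by (metis vector_eq_rdot inner_commute)
  then show ?thesis by (simp add: matrix_eq)
qed

lemma psi_eqI:
  assumes "\<And>x y. det (joint_mat P1 P2 x y) = x \<bullet> (F *v y)"
  shows "psi P1 P2 = F"
  unfolding psi_def
proof (rule the_equality)
  show "\<forall>x y. det (joint_mat P1 P2 x y) = x \<bullet> (F *v y)"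
    using assms by blast
  show "G = F" if "\<forall>x y. det (joint_mat P1 P2 x y) = x \<bullet> (G *v y)" for G
    using assms that by (intro bilinear_form_unique) metis
qed

lemma det_joint_mat: "det (joint_mat P1 P2 x y) = x \<bullet> (psi P1 P2 *v y)"
proof -
  let ?d = "\<lambda>x y. det (joint_mat P1 P2 x y)"
  define F :: "real^3^3" where "F = (\<chi> i j. ?d (axis i 1) (axis j 1))"
  have expand: "v = (\<Sum>i\<in>UNIV. v$i *\<^sub>R axis i 1)" for v :: "real^3"
    by (simp add: vec_eq_iff axis_def forall_3 sum_3)
  have "?d x y = x \<bullet> (F *v y)" for x y
  proof -
    have "?d x y = (\<Sum>i\<in>UNIV. x$i * ?d (axis i 1) y)"
      by (subst expand[of x])
        (simp add: linear_sum[OF linear_det_joint_mat_left]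
          linear_cmul[OF linear_det_joint_mat_left])
    also have "\<dots> = (\<Sum>i\<in>UNIV. x$i * (\<Sum>j\<in>UNIV. y$j * ?d (axis i 1) (axis j 1)))"
    proof (intro sum.cong refl arg_cong[where f = "(*) _"])
      fix i
      show "?d (axis i 1) y = (\<Sum>j\<in>UNIV. y$j * ?d (axis i 1) (axis j 1))"
        by (subst expand[of y])
          (simp add: linear_sum[OF linear_det_joint_mat_right]
            linear_cmul[OF linear_det_joint_mat_right])
    qed
    also have "\<dots> = x \<bullet> (F *v y)"
      by (simp add: F_def inner_vec_def matrix_vector_mult_def mult.commute)
    finally show ?thesis .
  qed
  then show ?thesis
    using psi_eqI by metis
qed

end

theory Submission
  imports Defs
begin

text \<open>
  Collinear centers and a plane \<open>h\<close> avoiding them give coordinates in which the cameras are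
  \<open>M\<^sub>i\<^sup>-\<^sup>1 [I | s\<^sub>i e]\<close> with a common \<open>e\<close>, i.e. \<open>M\<^sub>i P\<^sub>i - M\<^sub>j P\<^sub>j\<close> is the rank-one matrix
  \<open>(s\<^sub>i - s\<^sub>j) e h\<^sup>T\<close>. Then \<open>\<psi> P\<^sub>i P\<^sub>j\<close> is a multiple of \<open>M\<^sub>i\<^sup>T [e] M\<^sub>j\<close>, so after normalizing
  \<open>M\<^sub>1 = I\<close> the triple is \<open>[e] M\<close>, \<open>[e] N\<close>, \<open>M\<^sup>T [e] N\<close>, and the stated conditions are read off from
  \<open>[e]\<^sup>3 = - |e|\<^sup>2 [e]\<close>. Conversely every rank-2 matrix whose left kernel is spanned by \<open>e\<close> has
  the form \<open>[e] M\<close> with \<open>M\<close> invertible.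
\<close>

section \<open>Vanishing of the joint determinant\<close>

lemma ex_nonzero_orthogonal_pair:
  fixes u v :: "real^3"
  obtains a where "a \<noteq> 0" "a \<bullet> u = 0" "a \<bullet> v = 0"
proof -
  have "dim {u, v} \<le> card {u, v}"
    by (rule dim_le_card) (auto intro: span_base)
  also have "\<dots> \<le> 2"
    by (simp add: card_insert_if)
  finally have "dim {u, v} < DIM(real^3)"
    by simp
  then obtain a where "a \<noteq> 0" "\<And>y. y \<in> span {u, v} \<Longrightarrow> orthogonal a y"
    by (rule orthogonal_to_subspace_exists) blast
  then show ?thesis
    by (intro that) (auto simp: orthogonal_def intro: span_base)
qed

lemma UNIV_6: "UNIV = {1, 2, 3, 4, 5, 6::6}"
  using exhaust_6 by auto

lemma sum_6: "sum f (UNIV::6 set) = f 1 + f 2 + f 3 + f 4 + f 5 + f 6"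
  unfolding UNIV_6 by (simp add: ac_simps)

text \<open>Multiplying the joint matrix from the left by the row \<open>(a, b)\<close> gives the
  three hypotheses, one for the camera columns and one for each of the last two columns. So
  \<open>(a, b)\<close> is a left null vector.\<close>

lemma det_joint_mat_eq_0_left:
  assumes "a v* P + b v* Q = 0" "a \<bullet> x = 0" "b \<bullet> y = 0" "a \<noteq> 0"
  shows "det (joint_mat P Q x y) = 0"
proof -
  define r :: "real^6" where "r = vector [a$1, a$2, a$3, b$1, b$2, b$3]"
  have "r \<noteq> 0"
    using assms(4) by (auto simp: r_def vec_eq_iff forall_6 forall_3)
  moreover have "transpose (joint_mat P Q x y) *v r = 0"
    using assms(1-3)
    by (simp del: transpose_matrix_vector add: r_def joint_mat_def vec_eq_iff forall_6 forall_4
        matrix_vector_mult_def transpose_def vector_matrix_mult_def sum_6 sum_3 inner_vec_def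
        algebra_simps)
  ultimately have "\<not> invertible (transpose (joint_mat P Q x y))"
    by (metis invertible_def matrix_left_invertible_ker)
  then show ?thesis
    by (metis det_transpose invertible_det_nz)
qed

text \<open>A common center padded with two zeros is a kernel vector of the joint matrix.
  Consequently cameras with nonzero \<open>psi\<close> have distinct centers.\<close>

lemma det_joint_mat_eq_0_right:
  assumes "P *v v = 0" "Q *v v = 0" "v \<noteq> 0"
  shows "det (joint_mat P Q x y) = 0"
proof -
  define r :: "real^6" where "r = vector [v$1, v$2, v$3, v$4, 0, 0]"
  have "r \<noteq> 0"
    using assms(3) by (auto simp: r_def vec_eq_iff forall_6 forall_4)
  moreover have "joint_mat P Q x y *v r = 0"
    using assms(1-2)
    by (simp add: r_def joint_mat_def vec_eq_iff forall_6 forall_3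
        matrix_vector_mult_def sum_6 sum_4)
  ultimately have "\<not> invertible (joint_mat P Q x y)"
    by (metis invertible_def matrix_left_invertible_ker)
  then show ?thesis
    by (metis invertible_det_nz)
qed

text \<open>A kernel vector of the singular joint matrix splits into a space vector \<open>v\<close>
  and the coefficients \<open>s\<close>, \<open>t\<close> of the columns of \<open>x\<close> and
  \<open>y\<close>; the two row blocks give the two equations.\<close>

lemma det_joint_mat_eq_0E:
  assumes "det (joint_mat P Q x y) = 0"
  obtains v s t where "(v, s, t) \<noteq> (0, 0, 0)" "P *v v + s *\<^sub>R x = 0" "Q *v v + t *\<^sub>R y = 0"
proof -
  have "\<not> invertible (joint_mat P Q x y)"
    using assms by (metis invertible_det_nz)
  then obtain r where r: "r \<noteq> 0" "joint_mat P Q x y *v r = 0"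
    by (metis invertible_left_inverse matrix_left_invertible_ker)
  define v :: "real^4" where "v = vector [r$1, r$2, r$3, r$4]"
  have v: "v$1 = r$1" "v$2 = r$2" "v$3 = r$3" "v$4 = r$4"
    by (simp_all add: v_def vector_def)
  show ?thesis
  proof
    show "(v, r$5, r$6) \<noteq> (0, 0, 0)"
      using r(1) by (auto simp: v vec_eq_iff forall_6 forall_4)
    show "P *v v + r$5 *\<^sub>R x = 0" "Q *v v + r$6 *\<^sub>R y = 0"
      using r(2)
      by (simp_all add: v joint_mat_def vec_eq_iff forall_6 forall_3
          matrix_vector_mult_def sum_6 sum_4 algebra_simps)
  qed
qed

section \<open>The form \<open>psi\<close> for cameras that differ by a rank-one matrix\<close>

lemma alternating_eq_cross_mat:
  fixes G :: "real^3^3"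
  assumes alt: "\<And>x. x \<bullet> (G *v x) = 0"
  obtains f where "G = cross_mat f"
proof
  \<comment> \<open>Polarization: expanding \<open>alt\<close> at \<open>x + y\<close> gives
    skew-symmetry, so three entries determine \<open>G\<close>.\<close>
  have skew: "x \<bullet> (G *v y) = - (y \<bullet> (G *v x))" for x y
    using alt[of "x + y"] alt[of x] alt[of y]
    by (simp add: matrix_vector_right_distrib inner_add_left inner_add_right)
  have "axis i 1 \<bullet> (G *v axis j 1) = G$i$j" for i j
    by (simp add: inner_axis' matrix_vector_mul_component inner_axis)
  with skew have "G$i$j = - G$j$i" for i j
    by metis
  from this[of 1 1] this[of 2 2] this[of 3 3] this[of 1 2] this[of 1 3] this[of 2 3]
  show "G = cross_mat (vector [G$3$2, G$1$3, G$2$1])"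
    by (simp add: cross_mat_def vec_eq_iff forall_3)
qed

lemma cross_eq_0_scaleR:
  fixes e f :: "real^3"
  assumes "cross3 f e = 0" "e \<noteq> 0"
  obtains c where "f = c *\<^sub>R e"
  using assms by (metis collinear_lemma cross_eq_0 cross_skew neg_equal_0_iff_equal scale_zero_left)

lemma cross_mat_scaleR: "cross_mat (c *\<^sub>R e) = c *\<^sub>R cross_mat e"
  by (simp add: cross_mat_def vec_eq_iff forall_3)

text \<open>
  If \<open>M x\<close>, \<open>N y\<close> and \<open>e\<close> are linearly dependent, a common normal \<open>a\<close> yields the left null vector
  \<open>(a\<^sup>T M, - a\<^sup>T N)\<close> of the joint matrix. Hence in the coordinates \<open>M x\<close>, \<open>N y\<close> the form is
  alternating with \<open>e\<close> in its kernel, and no \<open>6 \<times> 6\<close> determinant has to be expanded.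
\<close>

lemma psi_of_rank_one_difference:
  fixes M N :: "real^3^3"
  assumes M: "invertible M" and N: "invertible N" and e: "e \<noteq> 0"
    and diff: "\<And>v. M *v (P *v v) - N *v (Q *v v) = (h \<bullet> v) *\<^sub>R e"
  obtains c where "psi P Q = c *\<^sub>R (transpose M ** cross_mat e ** N)"
proof -
  obtain M' where M': "M ** M' = mat 1" "M' ** M = mat 1"
    using M by (auto simp: invertible_def)
  obtain N' where N': "N ** N' = mat 1" "N' ** N = mat 1"
    using N by (auto simp: invertible_def)
  have vanish: "det (joint_mat P Q x y) = 0"
    if "a \<noteq> 0" "a \<bullet> e = 0" "a \<bullet> (M *v x) = 0" "a \<bullet> (N *v y) = 0" for a x y
  proof (rule det_joint_mat_eq_0_left)
    show "(a v* M) v* P + (- (a v* N)) v* Q = 0"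
    proof (rule vector_eq_ldot[THEN iffD1], rule allI)
      fix v
      have "((a v* M) v* P + (- (a v* N)) v* Q) \<bullet> v = a \<bullet> (M *v (P *v v) - N *v (Q *v v))"
        by (simp add: inner_add_left inner_diff_right dot_lmul_matrix)
      then show "v \<bullet> ((a v* M) v* P + (- (a v* N)) v* Q) = v \<bullet> 0"
        using that(2) by (simp add: diff inner_commute)
    qed
    show "(a v* M) \<bullet> x = 0" "- (a v* N) \<bullet> y = 0"
      using that by (simp_all add: dot_lmul_matrix)
    show "a v* M \<noteq> 0"
      using that(1) M'(1) by (metis vector_matrix_mul_assoc vector_matrix_mul_rid vector_matrix_mult_0)
  qed
  define G where "G = transpose M' ** psi P Q ** N'"
  have G: "x \<bullet> (G *v y) = det (joint_mat P Q (M' *v x) (N' *v y))" for x y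
    by (simp add: det_joint_mat G_def matrix_vector_mul_assoc[symmetric] inner_commute[of x]
        dot_lmul_matrix) (simp add: inner_commute)
  have inv: "M *v (M' *v x) = x" "N *v (N' *v x) = x" for x
    by (simp_all add: matrix_vector_mul_assoc M' N')
  have "x \<bullet> (G *v x) = 0" for x
  proof -
    obtain a where "a \<noteq> 0" "a \<bullet> x = 0" "a \<bullet> e = 0"
      by (rule ex_nonzero_orthogonal_pair)
    then show ?thesis
      unfolding G by (intro vanish[of a]) (simp_all add: inv)
  qed
  then obtain f where f: "G = cross_mat f"
    by (rule alternating_eq_cross_mat)
  have "x \<bullet> (G *v e) = 0" for x
  proof -
    obtain a where "a \<noteq> 0" "a \<bullet> x = 0" "a \<bullet> e = 0"
      by (rule ex_nonzero_orthogonal_pair)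
    then show ?thesis
      unfolding G by (intro vanish[of a]) (simp_all add: inv)
  qed
  then have "cross3 f e = 0"
    by (metis cross_mat_mult f inner_eq_zero_iff)
  then obtain c where c: "f = c *\<^sub>R e"
    using e by (rule cross_eq_0_scaleR)
  have "transpose M ** transpose M' = mat 1"
    by (metis M'(2) matrix_transpose_mul transpose_mat)
  then have "psi P Q = transpose M ** G ** N"
    unfolding G_def by (metis M' N'(2) matrix_mul_assoc matrix_mul_lid matrix_mul_rid)
  then show ?thesis
    by (intro that[of c])
      (simp add: f c cross_mat_scaleR matrix_scalar_ac flip: scalar_matrix_assoc)
qed

text \<open>If \<open>psi\<close> vanished, a kernel vector of one well-chosen joint matrix would
  give a linear relation between three orthogonal vectors \<open>e\<close>, \<open>a\<close>,
  \<open>b\<close>. Its coefficients are then zero, and \<open>ker\<close>, which says that the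
  center of \<open>P\<close> misses the plane \<open>h\<close>, kills the space vector too.\<close>

lemma psi_nonzero_of_rank_one_difference:
  fixes M N :: "real^3^3"
  assumes M: "invertible M" and N: "invertible N" and e: "e \<noteq> 0"
    and diff: "\<And>v. M *v (P *v v) - N *v (Q *v v) = (h \<bullet> v) *\<^sub>R e"
    and ker: "\<And>v. P *v v = 0 \<Longrightarrow> h \<bullet> v = 0 \<Longrightarrow> v = 0"
  shows "psi P Q \<noteq> 0"
proof
  assume 0: "psi P Q = 0"
  obtain M' where M': "M ** M' = mat 1" "M' ** M = mat 1"
    using M by (auto simp: invertible_def)
  obtain N' where N': "N ** N' = mat 1" "N' ** N = mat 1"
    using N by (auto simp: invertible_def)
  \<comment> \<open>Both vectors of the pair are taken to be \<open>e\<close>. Together with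
    \<open>b = cross3 e a\<close> this gives an orthogonal basis.\<close>
  obtain a where a: "a \<noteq> 0" "a \<bullet> e = 0" "a \<bullet> e = 0"
    by (rule ex_nonzero_orthogonal_pair)
  define b where "b = cross3 e a"
  have b: "b \<bullet> e = 0" "b \<bullet> a = 0" "b \<noteq> 0"
    using a(1,2) e norm_and_cross_eq_0[of e a]
    by (auto simp: b_def dot_cross_self inner_commute)
  have "det (joint_mat P Q (M' *v a) (N' *v b)) = 0"
    by (simp add: det_joint_mat 0)
  then obtain v s t where v: "(v, s, t) \<noteq> (0, 0, 0)"
    and P: "P *v v + s *\<^sub>R (M' *v a) = 0" and Q: "Q *v v + t *\<^sub>R (N' *v b) = 0"
    by (rule det_joint_mat_eq_0E)
  have "M *v (P *v v + s *\<^sub>R (M' *v a)) = 0" "N *v (Q *v v + t *\<^sub>R (N' *v b)) = 0"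
    by (simp_all only: P Q matrix_vector_mult_0_right)
  then have "M *v (P *v v) + s *\<^sub>R a = 0" "N *v (Q *v v) + t *\<^sub>R b = 0"
    by (simp_all add: matrix_vector_right_distrib matrix_vector_mult_scaleR
        matrix_vector_mul_assoc M' N' del: matrix_vector_mult_0_right)
  \<comment> \<open>Subtracting the two kernel equations turns \<open>diff\<close> into a relation
    in the basis \<open>e\<close>, \<open>a\<close>, \<open>b\<close>; pairing with each basis
    vector isolates one coefficient.\<close>
  with diff[of v] have eq: "t *\<^sub>R b - s *\<^sub>R a = (h \<bullet> v) *\<^sub>R e"
    by (simp add: eq_neg_iff_add_eq_0[symmetric])
  have ab: "a \<bullet> b = 0"
    using b(2) by (simp add: inner_commute)
  have "e \<bullet> (t *\<^sub>R b - s *\<^sub>R a) = 0"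
    using a b by (simp add: inner_diff_right inner_commute)
  then have "h \<bullet> v = 0"
    using e by (simp add: eq)
  moreover have "a \<bullet> (t *\<^sub>R b - s *\<^sub>R a) = 0" "b \<bullet> (t *\<^sub>R b - s *\<^sub>R a) = 0"
    using a(2) b(1) by (simp_all add: eq)
  then have "s = 0" "t = 0"
    using a(1) b(2,3) ab by (simp_all add: inner_diff_right)
  ultimately show False
    using v P ker by simp
qed

section \<open>Coordinates adapted to collinear centers\<close>

lemma ex_nonorthogonal_finite:
  fixes S :: "'a::real_inner set"
  assumes "finite S" "0 \<notin> S"
  obtains h where "\<And>c. c \<in> S \<Longrightarrow> h \<bullet> c \<noteq> 0"
proof -
  have "\<exists>h. \<forall>c\<in>S. h \<bullet> c \<noteq> 0"
    using assms
  proof (induction S rule: finite_induct)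
    case (insert c S)
    then obtain h where h: "\<forall>s\<in>S. h \<bullet> s \<noteq> 0"
      by auto
    show ?case
    proof (cases "h \<bullet> c = 0")
      case False
      then show ?thesis
        using h by auto
    next
      case True
      \<comment> \<open>Moving \<open>h\<close> along \<open>c\<close> by \<open>t\<close> must
        avoid finitely many values: 0, which would leave \<open>c\<close> orthogonal, and for each
        \<open>s\<close> the value that would make \<open>s\<close> orthogonal. If
        \<open>c \<bullet> s = 0\<close>, the product with \<open>s\<close> does not change and the
        quotient is just 0.\<close>
      obtain t where t: "t \<notin> insert 0 ((\<lambda>s. - (h \<bullet> s) / (c \<bullet> s)) ` S)"
        using ex_new_if_finite[OF infinite_UNIV_char_0] insert.hyps(1)
      by (metis finite_imageI finite_insert)
      have "(h + t *\<^sub>R c) \<bullet> s \<noteq> 0" if "s \<in> S" for s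
      proof
        assume 0: "(h + t *\<^sub>R c) \<bullet> s = 0"
        then have "c \<bullet> s \<noteq> 0"
          using h that by (auto simp: inner_add_left)
        with 0 have "t = - (h \<bullet> s) / (c \<bullet> s)"
          by (simp add: inner_add_left field_simps eq_neg_iff_add_eq_0)
        then show False
          using t that by auto
      qed
      moreover have "(h + t *\<^sub>R c) \<bullet> c \<noteq> 0"
        using t insert.prems True by (simp add: inner_add_left)
      ultimately show ?thesis
        by (intro exI[of _ "h + t *\<^sub>R c"]) auto
    qed
  qed simp
  then show ?thesis
    using that by blast
qed

text \<open>The kernel is the orthogonal complement of the row space, which has dimension 3 in a
  space of dimension 4.\<close>

lemma camera_center:
  assumes "is_camera P"
  obtains c where "c \<noteq> 0" "center P = span {c}"
proof -
  have "mat_ker P = {y \<in> UNIV. \<forall>x \<in> span (rows P). orthogonal x y}"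
  proof (intro equalityI subsetI)
    fix y assume "y \<in> mat_ker P"
    then have y: "P *v y = 0"
      by (simp add: mat_ker_def)
    then show "y \<in> {y \<in> UNIV. \<forall>x \<in> span (rows P). orthogonal x y}"
      using orthogonal_nullspace_rowspace[OF y] by (auto simp: orthogonal_commute)
  next
    fix y assume "y \<in> {y \<in> UNIV. \<forall>x \<in> span (rows P). orthogonal x y}"
    then have "row i P \<bullet> y = 0" for i
      by (auto simp: orthogonal_def rows_def intro!: span_base)
    then show "y \<in> mat_ker P"
      by (simp add: mat_ker_def vec_eq_iff matrix_mult_dot row_def)
  qed
  moreover have "dim (span (rows P)) = 3"
    using assms by (simp add: is_camera_def row_rank_def dim_span)
  ultimately have dim: "dim (mat_ker P) = 1"
    using dim_subspace_orthogonal_to_vectors[OF subspace_span subspace_UNIV subset_UNIV, of "rows P"]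
    by simp
  have sub: "subspace (mat_ker P)"
    unfolding mat_ker_def
    by (auto simp: subspace_def matrix_vector_right_distrib matrix_vector_mult_scaleR)
  have "\<not> mat_ker P \<subseteq> {0}"
    using dim by (metis dim_eq_0 zero_neq_one)
  then obtain c where c: "c \<noteq> 0" "c \<in> mat_ker P"
    by blast
  have "span {c} = mat_ker P"
    by (rule subspace_dim_equal) (use sub c dim in \<open>simp_all add: span_minimal\<close>)
  then show ?thesis
    using c by (intro that[of c]) (simp_all add: center_def)
qed

lemma matrix_works_real:
  fixes f :: "real^'n \<Rightarrow> real^'m"
  assumes "linear f"
  shows "matrix f *v x = f x"
  using assms by (simp add: matrix_works linear_matrix_vector_mul_eq)

text \<open>A plane that misses the center is mapped isomorphically onto the image space.
  \<open>U\<close> inverts this map, and the last identity splits a vector into its part in the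
  plane and its part along the center.\<close>

lemma camera_affine_section:
  assumes P: "is_camera P" "center P = span {c}" and h: "h \<bullet> c = 1"
  obtains U where "P ** U = mat 1" "\<And>w. h \<bullet> (U *v w) = 0"
    "\<And>v. v = U *v (P *v v) + (h \<bullet> v) *\<^sub>R c"
proof -
  have ker: "P *v v = 0 \<longleftrightarrow> v \<in> span {c}" for v
    using P(2) by (auto simp: center_def mat_ker_def)
  obtain R where R: "P ** R = mat 1"
    using P(1) full_rank_surjective[of P] matrix_right_invertible_surjective[of P]
    by (auto simp: is_camera_def)
  \<comment> \<open>An arbitrary right inverse \<open>R\<close> is corrected along \<open>c\<close>
    to land in the plane \<open>h\<close>; the images under \<open>P\<close> do not change because
    \<open>P\<close> kills \<open>c\<close>.\<close>
  define U where "U = matrix (\<lambda>w. R *v w - (h \<bullet> (R *v w)) *\<^sub>R c)"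
  have U: "U *v w = R *v w - (h \<bullet> (R *v w)) *\<^sub>R c" for w
    unfolding U_def
    by (rule matrix_works_real[of "\<lambda>w. R *v w - (h \<bullet> (R *v w)) *\<^sub>R c"])
      (auto intro!: linearI simp: algebra_simps inner_add_right matrix_vector_mult_scaleR)
  have "P *v c = 0"
    by (simp add: ker span_base)
  then have PU: "P *v (U *v w) = w" for w
    by (simp add: U matrix_vector_mult_diff_distrib matrix_vector_mult_scaleR
        matrix_vector_mul_assoc R)
  have hU: "h \<bullet> (U *v w) = 0" for w
    by (simp add: U inner_diff_right h)
  show ?thesis
  proof
    show "P ** U = mat 1"
      by (simp add: matrix_eq PU flip: matrix_vector_mul_assoc)
    show "h \<bullet> (U *v w) = 0" for w
      by (rule hU)
    show "v = U *v (P *v v) + (h \<bullet> v) *\<^sub>R c" for v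
    proof -
      have "P *v (v - U *v (P *v v)) = 0"
        by (simp add: matrix_vector_mult_diff_distrib PU)
      then obtain k where k: "v - U *v (P *v v) = k *\<^sub>R c"
        unfolding ker span_singleton by auto
      have "h \<bullet> (v - U *v (P *v v)) = h \<bullet> v"
        by (simp add: inner_diff_right hU)
      then have "k = h \<bullet> v"
        by (simp add: k h)
      with k show ?thesis
        by (simp add: algebra_simps)
    qed
  qed
qed

lemma camera_invertible_on_plane:
  fixes U :: "real^3^4"
  assumes "center Q = span {c}" "h \<bullet> c = 1" "\<And>w. h \<bullet> (U *v w) = 0"
    and "P ** U = mat 1"
  shows "invertible (Q ** U)"
  unfolding invertible_left_inverse matrix_left_invertible_ker
proof (intro allI impI)
  fix w assume "(Q ** U) *v w = 0"
  then have "Q *v (U *v w) = 0"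
    by (simp add: matrix_vector_mul_assoc)
  then have "U *v w \<in> span {c}"
    using assms(1) unfolding center_def mat_ker_def by blast
  then obtain k where k: "U *v w = k *\<^sub>R c"
    by (auto simp: span_singleton)
  with assms(2) assms(3)[of w] have "U *v w = 0"
    by simp
  then have "P *v (U *v w) = 0"
    by (simp only: matrix_vector_mult_0_right)
  then show "w = 0"
    by (simp add: matrix_vector_mul_assoc assms(4))
qed

text \<open>In the chart \<open>h \<bullet> c = 1\<close> collinearity of the centers means that
  their differences are proportional. Each camera is composed with the matrix that makes it agree
  with \<open>P1\<close> on the plane \<open>h \<bullet> v = 0\<close>; what remains is a rank-one
  term, read off at the center \<open>c1\<close>.\<close>

lemma collinear_cameras_normal_form:
  assumes cam: "is_camera P1" "is_camera P2" "is_camera P3"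
    and coll: "collinear_centers P1 P2 P3" and ne: "psi P1 P2 \<noteq> 0"
  obtains M N e h s where "invertible M" "invertible N" "e \<noteq> 0"
    "\<And>v. M *v (P2 *v v) = P1 *v v + (h \<bullet> v) *\<^sub>R e"
    "\<And>v. N *v (P3 *v v) = P1 *v v + (s * (h \<bullet> v)) *\<^sub>R e"
proof -
  obtain d1 where d1: "d1 \<noteq> 0" "center P1 = span {d1}" using cam(1) by (rule camera_center)
  obtain d2 where d2: "d2 \<noteq> 0" "center P2 = span {d2}" using cam(2) by (rule camera_center)
  obtain d3 where d3: "d3 \<noteq> 0" "center P3 = span {d3}" using cam(3) by (rule camera_center)
  obtain h where h: "\<And>c. c \<in> {d1, d2, d3} \<Longrightarrow> h \<bullet> c \<noteq> 0"
    by (rule ex_nonorthogonal_finite[of "{d1, d2, d3}"]) (use d1 d2 d3 in auto)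
  define c where "c d = (1 / (h \<bullet> d)) *\<^sub>R d" for d
  have hc: "h \<bullet> c d = 1" if "h \<bullet> d \<noteq> 0" for d
    using that by (simp add: c_def)
  have span_c: "span {c d} = span {d}" if "h \<bullet> d \<noteq> 0" for d
    using span_image_scale[of "{d}" "\<lambda>_. 1 / (h \<bullet> d)"] that by (simp add: c_def)
  obtain c1 c2 c3 where c: "h \<bullet> c1 = 1" "h \<bullet> c2 = 1" "h \<bullet> c3 = 1"
    and P: "center P1 = span {c1}" "center P2 = span {c2}" "center P3 = span {c3}"
    using hc span_c h d1(2) d2(2) d3(2) by (metis insertCI)
  have Pc: "P1 *v c1 = 0" "P2 *v c2 = 0" "P3 *v c3 = 0"
    using P span_base[of c1 "{c1}"] span_base[of c2 "{c2}"] span_base[of c3 "{c3}"]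
    by (auto simp: center_def mat_ker_def)
  have nz: "c1 \<noteq> 0" "c2 \<noteq> 0"
    using c by auto
  \<comment> \<open>Coinciding centers would make every joint determinant of \<open>P1\<close> and
    \<open>P2\<close> vanish.\<close>
  have "c1 \<noteq> c2"
  proof
    assume "c1 = c2"
    then have "det (joint_mat P1 P2 x y) = x \<bullet> (0 *v y)" for x y
      using det_joint_mat_eq_0_right[of P1 c1 P2] Pc nz by simp
    then have "psi P1 P2 = 0"
      by (rule psi_eqI)
    with ne show False ..
  qed
  have "c1 \<notin> span {c2}"
    using c \<open>c1 \<noteq> c2\<close> by (auto simp: span_singleton)
  then have dim2: "dim {c1, c2} = 2"
    using nz by (simp add: dim_insert)
  obtain L where L: "subspace L" "dim L = 2" "center P1 \<subseteq> L" "center P2 \<subseteq> L" "center P3 \<subseteq> L"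
    using coll unfolding collinear_centers_def by blast
  then have cL: "c1 \<in> L" "c2 \<in> L" "c3 \<in> L"
    using P by (auto intro: span_base)
  have "span {c1, c2} = L"
    by (rule subspace_dim_equal) (use cL L dim2 in \<open>auto simp: span_minimal\<close>)
  with cL have "c3 \<in> span {c1, c2}"
    by simp
  then obtain a b where ab: "c3 = a *\<^sub>R c1 + b *\<^sub>R c2"
    by (auto simp: span_insert span_singleton algebra_simps diff_eq_eq)
  have "a + b = 1"
    using c ab by (simp add: inner_add_right)
  then have c3: "c1 - c3 = b *\<^sub>R (c1 - c2)"
    unfolding ab by (simp add: algebra_simps eq_diff_eq flip: scaleR_left_distrib)
  obtain U where U: "P1 ** U = mat 1" "\<And>w. h \<bullet> (U *v w) = 0"
    "\<And>v. v = U *v (P1 *v v) + (h \<bullet> v) *\<^sub>R c1"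
    using cam(1) P(1) c(1) by (rule camera_affine_section) blast
  \<comment> \<open>As \<open>P1\<close> kills \<open>c1\<close>, this is minus the image of the
    second center under \<open>P1\<close>, hence the epipole. The difference \<open>c1 - c2\<close>
    lies in the plane \<open>h\<close>, so \<open>U\<close> recovers it from
    \<open>e\<close>.\<close>
  define e where "e = P1 *v (c1 - c2)"
  have Ue: "c1 - c2 = U *v e"
    using U(3)[of "c1 - c2"] c by (simp add: e_def inner_diff_right)
  have e: "e \<noteq> 0"
    using Ue \<open>c1 \<noteq> c2\<close> by auto
  \<comment> \<open>One argument for both remaining cameras, used with \<open>s = 1\<close> for
    \<open>P2\<close> and \<open>s = b\<close> for \<open>P3\<close>.\<close>
  have step: "\<exists>M. invertible M \<and> (\<forall>v. M *v (Q *v v) = P1 *v v + (s * (h \<bullet> v)) *\<^sub>R e)"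
    if Q: "center Q = span {d}" "Q *v d = 0" "h \<bullet> d = 1" "c1 - d = s *\<^sub>R (c1 - c2)" for Q d s
  proof -
    have inv: "invertible (Q ** U)"
      using Q(1,3) U(2,1) by (rule camera_invertible_on_plane)
    then obtain M where M: "M ** (Q ** U) = mat 1" "(Q ** U) ** M = mat 1"
      by (auto simp: invertible_def)
    have MQU: "M *v (Q *v (U *v w)) = w" for w
      using M(1) by (simp add: matrix_vector_mul_assoc matrix_mul_assoc)
    have "M *v (Q *v v) = P1 *v v + (s * (h \<bullet> v)) *\<^sub>R e" for v
    proof -
      have "c1 = d + s *\<^sub>R (U *v e)"
        using Q(4) by (simp add: Ue algebra_simps)
      then have "Q *v c1 = s *\<^sub>R (Q *v (U *v e))"
        using Q(2) by (simp add: matrix_vector_right_distrib matrix_vector_mult_scaleR)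
      then have "M *v (Q *v c1) = s *\<^sub>R e"
        by (simp add: matrix_vector_mult_scaleR MQU)
      then show ?thesis
        by (subst U(3)[of v])
          (simp add: matrix_vector_right_distrib matrix_vector_mult_scaleR MQU)
    qed
    then show ?thesis
      using M by (auto simp: invertible_def)
  qed
  obtain M where M: "invertible M" "\<And>v. M *v (P2 *v v) = P1 *v v + (1 * (h \<bullet> v)) *\<^sub>R e"
    using step[OF P(2) Pc(2) c(2), of 1] by auto
  obtain N where N: "invertible N" "\<And>v. N *v (P3 *v v) = P1 *v v + (b * (h \<bullet> v)) *\<^sub>R e"
    using step[OF P(3) Pc(3) c(3) c3] by auto
  show ?thesis
    by (rule that[OF M(1) N(1) e]) (use M(2) N(2) in \<open>simp_all only: mult_1_left\<close>)
qed

section \<open>Factoring a matrix through the cross product with its left null vector\<close>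

lemma cross_mat_factor:
  fixes F :: "real^3^3"
  assumes e: "e \<noteq> 0" "transpose F *v e = 0" and n: "mat_ker F = span {n}" "n \<noteq> 0"
  obtains M where "invertible M" "F = cross_mat e ** M"
proof -
  \<comment> \<open>\<open>[e]\<^sup>2 = - |e|\<^sup>2\<close> on the complement of \<open>e\<close>, so the first term solves \<open>[e] M = F\<close>;
    the second is killed by \<open>[e]\<close> and makes \<open>M\<close> injective on \<open>ker F\<close>.\<close>
  define M where "M = matrix (\<lambda>v. - (1 / (e \<bullet> e)) *\<^sub>R cross3 e (F *v v) + (n \<bullet> v) *\<^sub>R e)"
  have M: "M *v v = - (1 / (e \<bullet> e)) *\<^sub>R cross3 e (F *v v) + (n \<bullet> v) *\<^sub>R e" for v
    unfolding M_def
    by (rule matrix_works_real[of "\<lambda>v. - (1 / (e \<bullet> e)) *\<^sub>R cross3 e (F *v v) + (n \<bullet> v) *\<^sub>R e"])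
      (auto intro!: linearI simp: algebra_simps inner_add_right matrix_vector_mult_scaleR
        cross_add_right cross_mult_right)
  have eF: "e \<bullet> (F *v v) = 0" for v
    using e(2) by (metis dot_lmul_matrix inner_zero_left transpose_matrix_vector)
  have eM: "cross3 e (M *v v) = F *v v" for v
  proof -
    have "cross3 e (cross3 e (F *v v)) = - (e \<bullet> e) *\<^sub>R (F *v v)"
      using eF[of v] by (simp add: Lagrange cross_triple)
    then show ?thesis
      using e(1) by (simp add: M Cross3.right_diff_distrib cross_mult_right)
  qed
  show ?thesis
  proof
    show "F = cross_mat e ** M"
      by (simp add: matrix_eq eM cross_mat_mult flip: matrix_vector_mul_assoc)
    show "invertible M"
      unfolding invertible_left_inverse matrix_left_invertible_ker
    proof (intro allI impI)
      fix v assume 0: "M *v v = 0"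
      with eM[of v] have Fv: "F *v v = 0"
        by simp
      then have "v \<in> span {n}"
        using n(1) by (auto simp: mat_ker_def)
      then obtain k where k: "v = k *\<^sub>R n"
        by (auto simp: span_singleton)
      have "(n \<bullet> v) *\<^sub>R e = 0"
        using 0 by (simp add: M Fv)
      with k n(2) e(1) show "v = 0"
        by simp
    qed
  qed
qed

section \<open>Triples realized by cameras with collinear centers\<close>

lemma proj_eq_sym: "u \<doteq> v \<Longrightarrow> v \<doteq> u"
  unfolding proj_eq_def by (force intro: exI[of _ "inverse c" for c])

lemma proj_eq_trans: "u \<doteq> v \<Longrightarrow> v \<doteq> w \<Longrightarrow> u \<doteq> w"
  unfolding proj_eq_def by (force intro: exI[of _ "c * d" for c d])

lemma scaleR_proj_eq: "c \<noteq> 0 \<Longrightarrow> c *\<^sub>R u \<doteq> u"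
  by (auto simp: proj_eq_def)

text \<open>The camera is the inverse of \<open>M\<close> times \<open>[I | s e]\<close>. It is
  already onto when restricted to \<open>v$4 = 0\<close>, hence of rank 3.\<close>

lemma ex_camera_with_parallel_projection:
  fixes M :: "real^3^3"
  assumes "invertible M"
  obtains P where "is_camera P"
    "\<And>v. M *v (P *v v) = vector [v$1, v$2, v$3] + (s * v$4) *\<^sub>R e"
proof -
  obtain M' where M': "M ** M' = mat 1" "M' ** M = mat 1"
    using assms by (auto simp: invertible_def)
  define g where "g v = (vector [v$1, v$2, v$3] + (s * v$4) *\<^sub>R e :: real^3)" for v :: "real^4"
  have "linear (\<lambda>v. M' *v g v)"
    by (intro linearI)
      (simp_all add: g_def vec_eq_iff forall_3 matrix_vector_mult_def sum_3 algebra_simps)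
  then have P: "matrix (\<lambda>v. M' *v g v) *v v = M' *v g v" for v
    by (rule matrix_works_real)
  show ?thesis
  proof
    have "\<exists>v. z = M' *v g v" for z
    proof
      show "z = M' *v g (vector [(M *v z)$1, (M *v z)$2, (M *v z)$3, 0])"
      proof -
        have "g (vector [(M *v z)$1, (M *v z)$2, (M *v z)$3, 0]) = M *v z"
          by (simp add: g_def vec_eq_iff forall_3) (simp add: vector_def)
        then show ?thesis
          by (simp add: matrix_vector_mul_assoc M')
      qed
    qed
    then show "is_camera (matrix (\<lambda>v. M' *v g v))"
      using full_rank_surjective[of "matrix (\<lambda>v. M' *v g v)"]
      by (simp add: is_camera_def P surj_def)
    show "M *v (matrix (\<lambda>v. M' *v g v) *v v) = vector [v$1, v$2, v$3] + (s * v$4) *\<^sub>R e" for v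
      unfolding P by (simp add: matrix_vector_mul_assoc M' flip: g_def)
  qed
qed

lemma collinear_cameras_iff_normal_form:
  assumes "F12 \<noteq> 0" "F13 \<noteq> 0" "F23 \<noteq> 0"
  shows "(\<exists>P1 P2 P3. is_camera P1 \<and> is_camera P2 \<and> is_camera P3 \<and>
            collinear_centers P1 P2 P3 \<and>
            F12 \<doteq> psi P1 P2 \<and> F13 \<doteq> psi P1 P3 \<and> F23 \<doteq> psi P2 P3) \<longleftrightarrow>
         (\<exists>M N e. invertible M \<and> invertible N \<and> e \<noteq> 0 \<and>
            F12 \<doteq> cross_mat e ** M \<and> F13 \<doteq> cross_mat e ** N \<and>
            F23 \<doteq> transpose M ** cross_mat e ** N)"
    (is "?L \<longleftrightarrow> ?R")
proof
  assume ?L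
  then obtain P1 P2 P3 where cam: "is_camera P1" "is_camera P2" "is_camera P3"
      "collinear_centers P1 P2 P3"
    and F: "F12 \<doteq> psi P1 P2" "F13 \<doteq> psi P1 P3" "F23 \<doteq> psi P2 P3"
    by blast
  have nz: "psi P1 P2 \<noteq> 0" "psi P1 P3 \<noteq> 0" "psi P2 P3 \<noteq> 0"
    using F assms by (auto simp: proj_eq_def)
  obtain M N e h s where inv: "invertible M" "invertible N" and e: "e \<noteq> 0"
    and M: "\<And>v. M *v (P2 *v v) = P1 *v v + (h \<bullet> v) *\<^sub>R e"
    and N: "\<And>v. N *v (P3 *v v) = P1 *v v + (s * (h \<bullet> v)) *\<^sub>R e"
    using collinear_cameras_normal_form[OF cam nz(1)] by blast
  have one: "invertible (mat 1 :: real^3^3)"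
    by (auto simp: invertible_def)
  \<comment> \<open>All three pairwise differences have the same direction \<open>e\<close>, and
    their row vectors are multiples of \<open>h\<close>.\<close>
  have diff: "mat 1 *v (P1 *v v) - M *v (P2 *v v) = (- h \<bullet> v) *\<^sub>R e"
    "mat 1 *v (P1 *v v) - N *v (P3 *v v) = ((- s *\<^sub>R h) \<bullet> v) *\<^sub>R e"
    "M *v (P2 *v v) - N *v (P3 *v v) = (((1 - s) *\<^sub>R h) \<bullet> v) *\<^sub>R e" for v
    by (simp_all add: M N algebra_simps)
  obtain c12 where c12: "psi P1 P2 = c12 *\<^sub>R (transpose (mat 1) ** cross_mat e ** M)"
    using one inv(1) e diff(1) by (rule psi_of_rank_one_difference)
  obtain c13 where c13: "psi P1 P3 = c13 *\<^sub>R (transpose (mat 1) ** cross_mat e ** N)"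
    using one inv(2) e diff(2) by (rule psi_of_rank_one_difference)
  obtain c23 where c23: "psi P2 P3 = c23 *\<^sub>R (transpose M ** cross_mat e ** N)"
    using inv e diff(3) by (rule psi_of_rank_one_difference)
  have "c12 \<noteq> 0" "c13 \<noteq> 0" "c23 \<noteq> 0"
    using nz c12 c13 c23 by auto
  then have "psi P1 P2 \<doteq> cross_mat e ** M" "psi P1 P3 \<doteq> cross_mat e ** N"
    "psi P2 P3 \<doteq> transpose M ** cross_mat e ** N"
    unfolding c12 c13 c23 by (simp_all add: scaleR_proj_eq)
  then show ?R
    using inv e F proj_eq_trans by blast
next
  assume ?R
  then obtain M N e where inv: "invertible M" "invertible N" and e: "e \<noteq> 0"
    and F: "F12 \<doteq> cross_mat e ** M" "F13 \<doteq> cross_mat e ** N"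
      "F23 \<doteq> transpose M ** cross_mat e ** N"
    by blast
  have one: "invertible (mat 1 :: real^3^3)"
    by (auto simp: invertible_def)
  define w where "w v = (vector [v$1, v$2, v$3] :: real^3)" for v :: "real^4"
  have ex: "\<exists>P. is_camera P \<and> (\<forall>v. A *v (P *v v) = w v + (s * v$4) *\<^sub>R e)"
    if "invertible A" for A s
    unfolding w_def using ex_camera_with_parallel_projection[OF that, of s e] by metis
  \<comment> \<open>The parameters 0, 1, 2 are pairwise distinct, which is what makes all three
    forms \<open>psi\<close> nonzero.\<close>
  obtain P1 where P1: "is_camera P1" "\<And>v. mat 1 *v (P1 *v v) = w v + (0 * v$4) *\<^sub>R e"
    using ex[OF one, of 0] by blast
  obtain P2 where P2: "is_camera P2" "\<And>v. M *v (P2 *v v) = w v + (1 * v$4) *\<^sub>R e"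
    using ex[OF inv(1), of 1] by blast
  obtain P3 where P3: "is_camera P3" "\<And>v. N *v (P3 *v v) = w v + (2 * v$4) *\<^sub>R e"
    using ex[OF inv(2), of 2] by blast
  have psi: "psi P Q \<doteq> transpose A ** cross_mat e ** B"
    if inv: "invertible A" "invertible B" and "s \<noteq> t"
      and P: "\<And>v. A *v (P *v v) = w v + (s * v$4) *\<^sub>R e"
      and Q: "\<And>v. B *v (Q *v v) = w v + (t * v$4) *\<^sub>R e" for A B P Q s t
  proof -
    have diff: "A *v (P *v v) - B *v (Q *v v) = (axis 4 (s - t) \<bullet> v) *\<^sub>R e" for v
      unfolding P Q by (simp only: inner_axis' inner_real_def add_diff_add diff_self add_0
          left_diff_distrib scaleR_left_diff_distrib)
    have ker: "v = 0" if "P *v v = 0" "axis 4 (s - t) \<bullet> v = 0" for v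
    proof -
      have v4: "v$4 = 0"
        using that(2) \<open>s \<noteq> t\<close> by (simp add: inner_axis')
      then have "w v = 0"
        using P[of v] that(1) by simp
      with v4 show ?thesis
        by (simp add: w_def vec_eq_iff forall_3 forall_4)
    qed
    have "psi P Q \<noteq> 0"
      using inv e diff ker by (rule psi_nonzero_of_rank_one_difference)
    moreover obtain c where "psi P Q = c *\<^sub>R (transpose A ** cross_mat e ** B)"
      using inv e diff by (rule psi_of_rank_one_difference)
    ultimately show ?thesis
      by (auto simp: proj_eq_def)
  qed
  have "psi P1 P2 \<doteq> cross_mat e ** M" "psi P1 P3 \<doteq> cross_mat e ** N"
    "psi P2 P3 \<doteq> transpose M ** cross_mat e ** N"
    using psi[OF one inv(1) _ P1(2) P2(2)] psi[OF one inv(2) _ P1(2) P3(2)]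
      psi[OF inv _ P2(2) P3(2)] by simp_all
  then have "F12 \<doteq> psi P1 P2" "F13 \<doteq> psi P1 P3" "F23 \<doteq> psi P2 P3"
    using F proj_eq_sym proj_eq_trans by blast+
  moreover have "collinear_centers P1 P2 P3"
    unfolding collinear_centers_def
  proof (intro exI conjI)
    \<comment> \<open>The center with parameter \<open>s\<close> is spanned by
      \<open>axis 4 1 - s *\<^sub>R b\<close>, so all centers lie on the line through
      \<open>axis 4 1\<close> and the point \<open>b\<close>, which is \<open>e\<close> placed at
      infinity.\<close>
    define b :: "real^4" where "b = vector [e$1, e$2, e$3, 0]"
    have b: "b$1 = e$1" "b$2 = e$2" "b$3 = e$3" "b$4 = 0"
      by (simp_all add: b_def vector_def)
    have "b \<noteq> 0"
      using e by (auto simp: vec_eq_iff b forall_3 forall_4)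
    moreover have "axis 4 1 \<notin> span {b}"
      by (auto simp: span_singleton vec_eq_iff forall_4 b axis_def)
    ultimately show "dim (span {axis 4 1, b}) = 2"
      by (simp add: dim_insert)
    have sub: "center P \<subseteq> span {axis 4 1, b}"
      if P: "\<And>v. A *v (P *v v) = w v + (s * v$4) *\<^sub>R e" for A P s
    proof
      fix v assume "v \<in> center P"
      then have "w v = - (s * v$4) *\<^sub>R e"
        using P[of v] by (simp add: center_def mat_ker_def eq_neg_iff_add_eq_0)
      then have "v = v$4 *\<^sub>R axis 4 1 + (- (s * v$4)) *\<^sub>R b"
        by (simp add: vec_eq_iff w_def forall_3 forall_4 b axis_def)
      then show "v \<in> span {axis 4 1, b}"
        by (metis insertCI span_add span_base span_scale)
    qed
    show "center P1 \<subseteq> span {axis 4 1, b}" "center P2 \<subseteq> span {axis 4 1, b}"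
      "center P3 \<subseteq> span {axis 4 1, b}"
      using sub P1(2) P2(2) P3(2) by metis+
  qed simp
  ultimately show ?L
    using P1 P2 P3 by blast
qed

section \<open>The transfer identity and epipoles\<close>

lemma vector_cross_mat: "x v* cross_mat e = cross3 x e"
  by (simp add: cross_mat_def cross3_def vec_eq_iff forall_3 vector_matrix_mult_def sum_3)

text \<open>By skew-symmetry the three cross-product factors in the middle are minus the cube of
  \<open>cross_mat e\<close>, and the triple product formula collapses this to a multiple of
  \<open>cross_mat e\<close>.\<close>

lemma cross_mat_transfer:
  "transpose (cross_mat e ** M) ** cross_mat e ** (cross_mat e ** N)
     = (e \<bullet> e) *\<^sub>R (transpose M ** cross_mat e ** N)"
proof -
  have cube: "transpose (cross_mat e) ** cross_mat e ** cross_mat e = (e \<bullet> e) *\<^sub>R cross_mat e"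
  proof -
    have "cross3 (cross3 e (cross3 e x)) e = (e \<bullet> e) *\<^sub>R cross3 e x" for x
      using Lagrange[of e e "cross3 e x"] cross_skew[of "cross3 e (cross3 e x)" e]
      by (simp add: dot_cross_self)
    then show ?thesis
      by (simp add: matrix_eq cross_mat_mult vector_cross_mat
          flip: matrix_vector_mul_assoc scaleR_matrix_vector_assoc)
  qed
  have "transpose (cross_mat e ** M) ** cross_mat e ** (cross_mat e ** N)
     = transpose M ** (transpose (cross_mat e) ** cross_mat e ** cross_mat e) ** N"
    by (simp add: matrix_transpose_mul matrix_mul_assoc)
  then show ?thesis
    unfolding cube by (simp add: matrix_scalar_ac flip: scalar_matrix_assoc)
qed

lemma epipole_unique:
  assumes "is_epipole F u" "F *v w = 0" "w \<noteq> 0"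
  shows "w \<doteq> u"
proof -
  have "w \<in> span {u}"
    using assms by (auto simp: is_epipole_def mat_ker_def)
  then show ?thesis
    using assms(3) by (auto simp: span_singleton proj_eq_def)
qed

lemma proj_eq_matrix_vector_0_iff:
  fixes A B :: "real^'n^'m"
  assumes "A \<doteq> B"
  shows "A *v v = 0 \<longleftrightarrow> B *v v = 0"
  using assms by (auto simp: proj_eq_def simp flip: scaleR_matrix_vector_assoc)

lemma proj_eq_transpose: "A \<doteq> B \<Longrightarrow> transpose A \<doteq> transpose B"
  for A B :: "real^'n^'m"
  by (auto simp: proj_eq_def transpose_scalar)

lemma proj_eq_matrix_mult:
  fixes A A' :: "real^'n^'m" and B B' :: "real^'k^'n"
  assumes "A \<doteq> A'" "B \<doteq> B'"
  shows "A ** B \<doteq> A' ** B'"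
proof -
  obtain a b where "a \<noteq> 0" "A = a *\<^sub>R A'" "b \<noteq> 0" "B = b *\<^sub>R B'"
    using assms by (auto simp: proj_eq_def)
  moreover from this have "A ** B = (b * a) *\<^sub>R (A' ** B')"
    by (simp add: matrix_scalar_ac flip: scalar_matrix_assoc)
  ultimately show ?thesis
    by (simp add: scaleR_proj_eq)
qed

lemma proj_eq_cross_mat: "u \<doteq> v \<Longrightarrow> cross_mat u \<doteq> cross_mat v"
  by (auto simp: proj_eq_def cross_mat_scaleR)

text \<open>The projective form of the transfer identity, valid for any representatives. It turns
  the normal form of the third matrix into the transfer condition and back.\<close>

lemma cross_mat_transfer_proj_eq:
  assumes "F \<doteq> cross_mat e ** M" "G \<doteq> cross_mat e ** N" "u \<doteq> e" "e \<noteq> 0"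
  shows "transpose F ** cross_mat u ** G \<doteq> transpose M ** cross_mat e ** N"
proof -
  have "transpose F ** cross_mat u ** G
      \<doteq> transpose (cross_mat e ** M) ** cross_mat e ** (cross_mat e ** N)"
    using assms by (intro proj_eq_matrix_mult proj_eq_transpose proj_eq_cross_mat)
  also have "\<dots> = (e \<bullet> e) *\<^sub>R (transpose M ** cross_mat e ** N)"
    by (rule cross_mat_transfer)
  finally show ?thesis
    using assms(4) proj_eq_trans scaleR_proj_eq by (metis inner_eq_zero_iff)
qed

lemma transpose_cross_mat_mult_vector: "transpose (cross_mat e ** M) *v e = 0"
  by (simp add: vector_cross_mat flip: vector_matrix_mul_assoc)

(* Naming: ej_i is the epipole with lower index j and upper index i; it spans the kernel of
   F^{ij}, where F^{ji} = transpose F^{ij} for i < j. *)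

theorem proposition3p4:
  fixes F12 F13 F23 :: "real^3^3"
    and e1_2 e1_3 e2_1 e2_3 e3_1 e3_2 :: "real^3"
  assumes "is_fundamental F12" and "is_fundamental F13" and "is_fundamental F23"
    and "is_epipole (transpose F12) e1_2" and "is_epipole (transpose F13) e1_3"
    and "is_epipole F12 e2_1" and "is_epipole (transpose F23) e2_3"
    and "is_epipole F13 e3_1" and "is_epipole F23 e3_2"
  shows "(\<exists>P1 P2 P3. is_camera P1 \<and> is_camera P2 \<and> is_camera P3 \<and>
            collinear_centers P1 P2 P3 \<and>
            F12 \<doteq> psi P1 P2 \<and> F13 \<doteq> psi P1 P3 \<and> F23 \<doteq> psi P2 P3) \<longleftrightarrow>
         (e1_2 \<doteq> e1_3 \<and> e2_1 \<doteq> e2_3 \<and> e3_1 \<doteq> e3_2 \<and>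
          transpose F12 ** cross_mat e1_2 ** F13 \<doteq> F23)"
    (is "?L \<longleftrightarrow> ?R")
proof -
  have nz: "F12 \<noteq> 0" "F13 \<noteq> 0" "F23 \<noteq> 0"
    using assms(1-3) by (auto simp: is_fundamental_def)
  show ?thesis
    unfolding collinear_cameras_iff_normal_form[OF nz]
  proof
    assume "\<exists>M N e. invertible M \<and> invertible N \<and> e \<noteq> 0 \<and>
      F12 \<doteq> cross_mat e ** M \<and> F13 \<doteq> cross_mat e ** N \<and>
      F23 \<doteq> transpose M ** cross_mat e ** N"
    then obtain M N e where inv: "invertible M" "invertible N" and e: "e \<noteq> 0"
      and F: "F12 \<doteq> cross_mat e ** M" "F13 \<doteq> cross_mat e ** N"
        "F23 \<doteq> transpose M ** cross_mat e ** N"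
      by blast
    obtain M' where M': "M ** M' = mat 1"
      using inv(1) by (auto simp: invertible_def)
    obtain N' where N': "N ** N' = mat 1"
      using inv(2) by (auto simp: invertible_def)
    \<comment> \<open>Since \<open>cross3 e e = 0\<close>, the preimages of \<open>e\<close> under
      \<open>M\<close> and \<open>N\<close> give the remaining epipoles: \<open>M' *v e\<close> is
      killed by \<open>F12\<close> and \<open>transpose F23\<close>, \<open>N' *v e\<close> by
      \<open>F13\<close> and \<open>F23\<close>.\<close>
    have Me: "M *v (M' *v e) = e" "N *v (N' *v e) = e"
      by (simp_all add: matrix_vector_mul_assoc M' N')
    then have nze: "M' *v e \<noteq> 0" "N' *v e \<noteq> 0"
      using e by auto
    have F23t: "transpose F23 \<doteq> transpose (transpose M ** cross_mat e ** N)"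
      using F(3) by (rule proj_eq_transpose)
    have tr: "transpose (transpose M ** cross_mat e ** N) *v (M' *v e) = 0"
      by (simp add: matrix_transpose_mul vector_cross_mat Me flip: matrix_vector_mul_assoc)
    have e1: "e \<doteq> e1_2" "e \<doteq> e1_3"
      using assms(4,5) e proj_eq_matrix_vector_0_iff[OF proj_eq_transpose[OF F(1)], of e]
        proj_eq_matrix_vector_0_iff[OF proj_eq_transpose[OF F(2)], of e]
      by (auto intro!: epipole_unique simp: transpose_cross_mat_mult_vector
          simp del: transpose_matrix_vector)
    have e2: "M' *v e \<doteq> e2_1" "M' *v e \<doteq> e2_3"
      using assms(6,7) nze tr proj_eq_matrix_vector_0_iff[OF F(1), of "M' *v e"]
        proj_eq_matrix_vector_0_iff[OF F23t, of "M' *v e"]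
      by (auto intro!: epipole_unique simp: cross_mat_mult Me
          simp del: transpose_matrix_vector simp flip: matrix_vector_mul_assoc)
    have e3: "N' *v e \<doteq> e3_1" "N' *v e \<doteq> e3_2"
      using assms(8,9) nze proj_eq_matrix_vector_0_iff[OF F(2), of "N' *v e"]
        proj_eq_matrix_vector_0_iff[OF F(3), of "N' *v e"]
      by (auto intro!: epipole_unique simp: cross_mat_mult Me
          simp flip: matrix_vector_mul_assoc)
    have "transpose F12 ** cross_mat e1_2 ** F13 \<doteq> F23"
      using cross_mat_transfer_proj_eq[OF F(1,2) proj_eq_sym[OF e1(1)] e] proj_eq_sym[OF F(3)]
      by (rule proj_eq_trans)
    then show ?R
      using e1 e2 e3 proj_eq_sym proj_eq_trans by blast
  next
    assume R: ?R
    have e: "e1_2 \<noteq> 0" "transpose F12 *v e1_2 = 0"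
      using assms(4) span_base[of e1_2 "{e1_2}"] by (auto simp: is_epipole_def mat_ker_def)
    have "transpose F13 *v e1_3 = 0"
      using assms(5) span_base[of e1_3 "{e1_3}"] by (auto simp: is_epipole_def mat_ker_def)
    \<comment> \<open>Agreement of the epipoles in the first view lets \<open>F12\<close> and
      \<open>F13\<close> be factored through the same \<open>cross_mat e1_2\<close>.\<close>
    then have e': "transpose F13 *v e1_2 = 0"
      using R by (auto simp: proj_eq_def matrix_vector_mult_scaleR simp del: transpose_matrix_vector)
    have "mat_ker F12 = span {e2_1}" "e2_1 \<noteq> 0"
      using assms(6) by (auto simp: is_epipole_def)
    with e obtain M where M: "invertible M" "F12 = cross_mat e1_2 ** M"
      by (rule cross_mat_factor)
    have "mat_ker F13 = span {e3_1}" "e3_1 \<noteq> 0"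
      using assms(8) by (auto simp: is_epipole_def)
    with e(1) e' obtain N where N: "invertible N" "F13 = cross_mat e1_2 ** N"
      by (rule cross_mat_factor)
    have refl: "u \<doteq> u" for u :: "'a::real_vector"
      using scaleR_proj_eq[of 1 u] by simp
    \<comment> \<open>With both factorizations inserted, the transfer condition expresses
      \<open>F23\<close> by \<open>M\<close> and \<open>N\<close>.\<close>
    have "F23 \<doteq> transpose M ** cross_mat e1_2 ** N"
      using proj_eq_sym[OF cross_mat_transfer_proj_eq[OF refl refl refl e(1), of M N]] R
      unfolding M(2)[symmetric] N(2)[symmetric] by (meson proj_eq_sym proj_eq_trans)
    then show "\<exists>M N e. invertible M \<and> invertible N \<and> e \<noteq> 0 \<and>
      F12 \<doteq> cross_mat e ** M \<and> F13 \<doteq> cross_mat e ** N \<and>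
      F23 \<doteq> transpose M ** cross_mat e ** N"
      using M(1) N(1) e(1) refl[of F12] refl[of F13] unfolding M(2) N(2) by blast
  qed
qed

end
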